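(* Let $M$ be a loopless matroid of rank $r$ with set of bases $\mathcal{B}(M)$. Then $Y^{\mathrm{top}}_M(s)$ has a zero of order $r$ at $s=0$, and $$\lim_{s\to 0}\frac{Y^{\mathrm{top}}_M(s)}{s^r}=(-1)^r\,|\mathcal{B}(M)|.$$
   Context: For a loopless matroid $M$ on a finite ground set $E$, $\mathcal{L}(M)$ is its lattice of flats (with bottom $\varnothing$ and top $E$), $\mu_{F,G}$ is the Möbius function of $\mathcal{L}(M)$, and for a flat $F$, $M|_F$ and $M/F$ denote restriction to and contraction by $F$ (both are loopless). The characteristic polynomial is $\chi_M(x)=\sum_{F\in\mathcal{L}(M)}\mu_{\varnothing,F}\,x^{\mathrm{rk}(M)-\mathrm{rk}_M(F)}$, and for $\mathrm{rk}(M)>0$ the reduced characteristic polynomial is $\overline{\chi}_M(x)=\chi_M(x)/(x-1)$. The topological zeta function $Z^{\mathrm{top}}_M(s)\in\mathbb{Q}(s)$ and its Möbius transform $Y^{\mathrm{top}}_M(s)\in\mathbb{Q}(s)$ are defined for all loopless matroids recursively as follows. If $\mathrm{rk}(M)=0$, then $Z^{\mathrm{top}}_M(s)=Y^{\mathrm{top}}_M(s)=1$. If $\mathrm{rk}(M)=r>0$ and $|E|=n$, then $$Z^{\mathrm{top}}_M(s)=\frac{1}{ns+r}\sum_{F\in\mathcal{L}(M),\ F\neq E}Z^{\mathrm{top}}_{M|_F}(s)\,\overline{\chi}_{M/F}(1),\qquad Y^{\mathrm{top}}_M(s)=\sum_{F\in\mathcal{L}(M)}Z^{\mathrm{top}}_{M|_F}(s)\,\mu_{F,E}.$$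 *)

theory Defs
  imports
    Complex_Main
    "HOL-Computational_Algebra.Computational_Algebra"
    "HOL-Computational_Algebra.Field_as_Ring"
begin

section \<open>Matroids\<close>

record 'a indep_system =
  ground :: "'a set"
  indeps :: "'a set set"

locale matroid =
  fixes M :: "'a indep_system"
  assumes finite_ground: "finite (ground M)"
    and indeps_subset: "I \<in> indeps M \<Longrightarrow> I \<subseteq> ground M"
    and empty_indep: "{} \<in> indeps M"
    and indep_mono: "I \<in> indeps M \<Longrightarrow> J \<subseteq> I \<Longrightarrow> J \<in> indeps M"
    and augment: "I \<in> indeps M \<Longrightarrow> J \<in> indeps M \<Longrightarrow> card I < card J \<Longrightarrow>
      \<exists>x\<in>J - I. insert x I \<in> indeps M"

locale loopless_matroid = matroid +
  assumes loopless: "x \<in> ground M \<Longrightarrow> {x} \<in> indeps M"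

definition bases :: "'a indep_system \<Rightarrow> 'a set set" where
  "bases M = {B \<in> indeps M. \<forall>I\<in>indeps M. B \<subseteq> I \<longrightarrow> I = B}"

definition rk :: "'a indep_system \<Rightarrow> 'a set \<Rightarrow> nat" where
  "rk M A = Max (card ` {I \<in> indeps M. I \<subseteq> A})"

abbreviation matroid_rank :: "'a indep_system \<Rightarrow> nat" where
  "matroid_rank M \<equiv> rk M (ground M)"

definition flats :: "'a indep_system \<Rightarrow> 'a set set" where
  "flats M = {F. F \<subseteq> ground M \<and> (\<forall>x\<in>ground M - F. rk M F < rk M (insert x F))}"

definition restriction :: "'a indep_system \<Rightarrow> 'a set \<Rightarrow> 'a indep_system" where
  "restriction M A = \<lparr>ground = A, indeps = {I \<in> indeps M. I \<subseteq> A}\<rparr>"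

definition contraction :: "'a indep_system \<Rightarrow> 'a set \<Rightarrow> 'a indep_system" where
  "contraction M A = \<lparr>ground = ground M - A,
     indeps = {I. I \<subseteq> ground M - A \<and> (\<exists>B\<in>bases (restriction M A). I \<union> B \<in> indeps M)}\<rparr>"

lemma ground_restriction [simp]: "ground (restriction M A) = A"
  by (simp add: restriction_def)


section \<open>Moebius function and characteristic polynomial\<close>

text \<open>
  The Moebius function of a family \<open>L\<close> of finite sets ordered by inclusion. The finiteness
  test on \<open>G\<close> only serves termination.
\<close>

function moebius :: "'a set set \<Rightarrow> 'a set \<Rightarrow> 'a set \<Rightarrow> int" where
  "moebius L F G =
     (if F = G then 1
      else if F \<subset> G \<and> finite G then - (\<Sum>H | H \<in> L \<and> F \<subseteq> H \<and> H \<subset> G. moebius L F H)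
      else 0)"
  by auto
termination
  by (relation "measure (\<lambda>(L, F, G). card G)") (auto intro: psubset_card_mono)

declare moebius.simps [simp del]

definition char_poly :: "'a indep_system \<Rightarrow> int poly" where
  "char_poly M =
     (\<Sum>F\<in>flats M. monom (moebius (flats M) {} F) (matroid_rank M - rk M F))"

text \<open>
  For a loopless matroid of positive rank, \<open>x - 1\<close> divides the characteristic polynomial, so
  the following division is exact.
\<close>

definition reduced_char_poly :: "'a indep_system \<Rightarrow> int poly" where
  "reduced_char_poly M = char_poly M div [:-1, 1:]"


section \<open>Rational functions\<close>

text \<open>The field of rational functions over the rationals is \<^typ>\<open>rat poly fract\<close>.\<close>

definition fract_var :: "rat poly fract" where
  "fract_var = Fract [:0, 1:] 1"

text \<open>
  The function \<open>quot_of_fract\<close> yields numerator and denominator in lowest terms, so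
  \<open>eval_fract f\<close> is the function represented by \<open>f\<close> away from the poles of \<open>f\<close>; at a pole
  its value is 0 since division by 0 is 0.
\<close>

definition eval_fract :: "rat poly fract \<Rightarrow> 'a :: field_char_0 \<Rightarrow> 'a" where
  "eval_fract f z = (case quot_of_fract f of (p, q) \<Rightarrow>
     poly (map_poly of_rat p) z / poly (map_poly of_rat q) z)"

definition has_zero_of_order :: "rat poly fract \<Rightarrow> rat \<Rightarrow> nat \<Rightarrow> bool" where
  "has_zero_of_order f a k \<longleftrightarrow> f \<noteq> 0 \<and>
     (case quot_of_fract f of (p, q) \<Rightarrow> int (order a p) - int (order a q) = int k)"


section \<open>The topological zeta function and its Moebius transform\<close>

text \<open>The value for an infinite ground set is arbitrary; the test only serves termination.\<close>

function Ztop :: "'a indep_system \<Rightarrow> rat poly fract" where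
  "Ztop M =
     (if infinite (ground M) then 0
      else if matroid_rank M = 0 then 1
      else 1 / (of_nat (card (ground M)) * fract_var + of_nat (matroid_rank M)) *
        (\<Sum>F | F \<in> flats M \<and> F \<noteq> ground M.
           Ztop (restriction M F) * of_int (poly (reduced_char_poly (contraction M F)) 1)))"
  by auto
termination
  by (relation "measure (\<lambda>M. card (ground M))") (auto simp: flats_def intro!: psubset_card_mono)

declare Ztop.simps [simp del]

definition Ytop :: "'a indep_system \<Rightarrow> rat poly fract" where
  "Ytop M =
     (if matroid_rank M = 0 then 1
      else (\<Sum>F\<in>flats M. Ztop (restriction M F) * of_int (moebius (flats M) F (ground M))))"

end

theory Submission
  imports Defs
begin

text \<open>
  Write \<open>L\<close> for the lattice of flats, \<open>n\<close> for the size of the ground set \<open>E\<close>, and \<open>Z\<^sub>K\<close>, \<open>Y\<^sub>K\<close> for the two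
  functions of the restriction to \<open>K\<close>. Since the reduced characteristic polynomial at 1 is the derivative of
  the characteristic polynomial at 1, the recursion for \<open>Z\<close> reads
  \<open>(|K| s + rk K) Z\<^sub>K = (\<Sum>G \<subseteq> K. (rk K - rk G) Y\<^sub>G)\<close>. As \<open>Z\<^sub>K = (\<Sum>G \<subseteq> K. Y\<^sub>G)\<close>, this is
  \<open>|K| s Z\<^sub>K = - (\<Sum>G \<subseteq> K. rk G Y\<^sub>G)\<close>. Moebius inversion over \<open>L\<close> turns it into a recursion over the
  hyperplanes \<open>H\<close>, namely \<open>(n s + r) Y\<^sub>E = - s (\<Sum>H. |E - H| Y\<^sub>H)\<close>. Each factor \<open>s\<close> accounts for one
  order of vanishing, and the leading coefficients satisfy, up to sign, the same recursion as the
  numbers of bases: removing an element \<open>e\<close> from a basis \<open>B\<close> leaves a basis of the hyperplane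
  spanned by \<open>B - {e}\<close>, which \<open>e\<close> avoids.
\<close>

section \<open>Rank, closure and flats\<close>

context matroid
begin

lemma finite_indeps: "finite (indeps M)"
  by (rule finite_subset[of _ "Pow (ground M)"]) (auto simp: finite_ground dest: indeps_subset)

lemma finite_indep: "I \<in> indeps M \<Longrightarrow> finite I"
  using finite_ground finite_subset indeps_subset by blast

lemma finite_flats: "finite (flats M)"
  by (rule finite_subset[of _ "Pow (ground M)"]) (auto simp: finite_ground flats_def)

lemma card_le_rk: "I \<in> indeps M \<Longrightarrow> I \<subseteq> A \<Longrightarrow> card I \<le> rk M A"
  unfolding rk_def using finite_indeps by (intro Max_ge) auto

lemma rk_attained: "\<exists>I\<in>indeps M. I \<subseteq> A \<and> card I = rk M A"
proof -
  have "rk M A \<in> card ` {I \<in> indeps M. I \<subseteq> A}"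
    unfolding rk_def using finite_indeps empty_indep by (intro Max_in) auto
  then show ?thesis by auto
qed

lemma rk_mono: "A \<subseteq> B \<Longrightarrow> rk M A \<le> rk M B"
  using rk_attained[of A] card_le_rk[of _ B] by (metis order.trans)

text \<open>Augmentation against an independent subset of \<open>A\<close> of size
  \<open>rk M A\<close> adds one element at a time, so the deficit \<open>rk M A - card I\<close>
  drops until it reaches 0.\<close>

lemma extend_indep:
  assumes "I \<in> indeps M" "I \<subseteq> A"
  shows "\<exists>J\<in>indeps M. I \<subseteq> J \<and> J \<subseteq> A \<and> card J = rk M A"
  using assms
proof (induction "rk M A - card I" arbitrary: I rule: less_induct)
  case less
  show ?case
  proof (cases "card I = rk M A")
    case False
    then have lt: "card I < rk M A" using card_le_rk less.prems by (metis nat_less_le)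
    obtain J where J: "J \<in> indeps M" "J \<subseteq> A" "card J = rk M A" using rk_attained by blast
    obtain x where x: "x \<in> J - I" "insert x I \<in> indeps M"
      using augment[of I J] less.prems J lt by auto
    have "card (insert x I) = Suc (card I)" using x finite_indep less.prems by auto
    then have "\<exists>K\<in>indeps M. insert x I \<subseteq> K \<and> K \<subseteq> A \<and> card K = rk M A"
      using less.hyps[of "insert x I"] x J less.prems lt by auto
    then show ?thesis by blast
  qed (use less.prems in blast)
qed

lemma rk_insert_le: "rk M (insert x A) \<le> Suc (rk M A)"
proof -
  obtain I where I: "I \<in> indeps M" "I \<subseteq> insert x A" "card I = rk M (insert x A)"
    using rk_attained by blast
  have "card (I - {x}) \<le> rk M A"
    using I by (intro card_le_rk) (auto intro: indep_mono)
  moreover have "card I \<le> Suc (card (I - {x}))"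
    by (metis card.infinite card_Diff1_le card_Suc_Diff1 I(1) finite_indep Suc_leI le_Suc_eq
        Diff_empty Diff_insert0 order_refl)
  ultimately show ?thesis using I by simp
qed

lemma rk_empty: "rk M {} = 0"
  using rk_attained[of "{}"] by auto

lemma rk_indep: "I \<in> indeps M \<Longrightarrow> rk M I = card I"
  using rk_attained[of I] card_le_rk[of I I] finite_indep
  by (metis card_mono order_antisym order_refl)

text \<open>A largest independent \<open>I\<close> in \<open>A\<close> extends to \<open>J\<close>
  in \<open>B\<close> and then to \<open>K\<close> in \<open>insert x B\<close>. If \<open>x\<close>
  raised the rank of \<open>B\<close>, it would lie in \<open>K\<close>, so
  \<open>insert x I\<close> would be independent and too large for
  \<open>insert x A\<close>.\<close>

lemma rk_insert_eq_mono:
  assumes "A \<subseteq> B" "rk M (insert x A) = rk M A"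
  shows "rk M (insert x B) = rk M B"
proof (rule ccontr)
  assume neq: "rk M (insert x B) \<noteq> rk M B"
  then have x: "x \<notin> B" by (auto simp: insert_absorb)
  obtain I where I: "I \<in> indeps M" "I \<subseteq> A" "card I = rk M A" using rk_attained by blast
  then obtain J where J: "J \<in> indeps M" "I \<subseteq> J" "J \<subseteq> B" "card J = rk M B"
    using extend_indep[of I B] assms(1) by blast
  then obtain K where K: "K \<in> indeps M" "J \<subseteq> K" "K \<subseteq> insert x B" "card K = rk M (insert x B)"
    using extend_indep[of J "insert x B"] by blast
  have "x \<in> K"
  proof (rule ccontr)
    assume "x \<notin> K"
    then have "K \<subseteq> B" using K(3) by blast
    then have "card K \<le> rk M B" by (rule card_le_rk[OF K(1)])
    moreover have "rk M B \<le> rk M (insert x B)" by (intro rk_mono) auto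
    ultimately show False using K(4) neq by simp
  qed
  then have "insert x I \<in> indeps M" using K J by (blast intro: indep_mono[OF K(1)])
  then have "card (insert x I) \<le> rk M (insert x A)" using I by (intro card_le_rk) auto
  moreover have "x \<notin> I" using x J by blast
  then have "card (insert x I) = Suc (card I)" using finite_indep[OF I(1)] by simp
  ultimately show False using assms I by simp
qed

text \<open>Every independent set extends to one of full rank, so maximality under inclusion and
  maximality of size agree.\<close>

lemma bases_eq: "bases M = {B \<in> indeps M. card B = matroid_rank M}"
proof (intro equalityI subsetI)
  fix B assume "B \<in> bases M"
  then show "B \<in> {B \<in> indeps M. card B = matroid_rank M}"
    using extend_indep[of B "ground M"] indeps_subset unfolding bases_def by blast
next
  fix B assume B: "B \<in> {B \<in> indeps M. card B = matroid_rank M}"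
  then have "I = B" if "I \<in> indeps M" "B \<subseteq> I" for I
    using that card_le_rk[of I "ground M"] indeps_subset[of I] finite_indep[of I]
      card_seteq[of I B] by auto
  then show "B \<in> bases M" using B unfolding bases_def by auto
qed

lemma finite_bases: "finite (bases M)"
  using finite_indeps by (simp add: bases_def)

lemma bases_nonempty: "bases M \<noteq> {}"
  using rk_attained[of "ground M"] unfolding bases_eq by auto

section \<open>The closure operator\<close>

definition closure :: "'a set \<Rightarrow> 'a set" where
  "closure A = {x \<in> ground M. rk M (insert x A) = rk M A}"

lemma subset_closure: "A \<subseteq> ground M \<Longrightarrow> A \<subseteq> closure A"
  by (auto simp: closure_def insert_absorb)

text \<open>If the closure had larger rank, augmenting a largest independent set of \<open>A\<close>
  from it would add a point that raises the rank of \<open>A\<close>, which no point of the closure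
  does.\<close>

lemma rk_closure:
  assumes "A \<subseteq> ground M"
  shows "rk M (closure A) = rk M A"
proof (rule antisym)
  obtain I where I: "I \<in> indeps M" "I \<subseteq> A" "card I = rk M A" using rk_attained by blast
  obtain J where J: "J \<in> indeps M" "J \<subseteq> closure A" "card J = rk M (closure A)"
    using rk_attained by blast
  show "rk M (closure A) \<le> rk M A"
  proof (rule ccontr)
    assume "\<not> ?thesis"
    then obtain x where x: "x \<in> J - I" "insert x I \<in> indeps M" using augment[of I J] I J by auto
    then have "card (insert x I) \<le> rk M (insert x A)" using I by (intro card_le_rk) auto
    moreover have "rk M (insert x A) = rk M A" using x J by (auto simp: closure_def)
    ultimately show False using x I finite_indep by auto
  qed
qed (intro rk_mono subset_closure assms)

lemma flat_subset: "F \<in> flats M \<Longrightarrow> F \<subseteq> ground M"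
  by (simp add: flats_def)

lemma finite_flat: "F \<in> flats M \<Longrightarrow> finite F"
  using flat_subset finite_ground finite_subset by blast

lemma closure_flat:
  assumes "A \<subseteq> ground M"
  shows "closure A \<in> flats M"
proof -
  have "rk M (closure A) < rk M (insert x (closure A))" if "x \<in> ground M - closure A" for x
  proof -
    have "rk M (insert x A) \<noteq> rk M A" using that by (auto simp: closure_def)
    then have "rk M A < rk M (insert x A)" using rk_mono[of A "insert x A"] by (simp add: subset_insertI)
    also have "\<dots> \<le> rk M (insert x (closure A))"
      using subset_closure[OF assms] by (intro rk_mono) auto
    finally show ?thesis by (simp add: rk_closure assms)
  qed
  then show ?thesis by (auto simp: flats_def closure_def)
qed

text \<open>A point that does not raise the rank of \<open>A\<close> does not raise that of the
  larger set \<open>K\<close> either, so it lies in the flat \<open>K\<close>. Together with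
  \<open>closure_flat\<close>, the closure is the least flat above \<open>A\<close>.\<close>

lemma closure_minimal: "K \<in> flats M \<Longrightarrow> A \<subseteq> K \<Longrightarrow> closure A \<subseteq> K"
  using rk_insert_eq_mono[of A K] by (force simp: closure_def flats_def)

lemma flat_eqI:
  assumes "F \<in> flats M" "G \<subseteq> ground M" "F \<subseteq> G" "rk M G \<le> rk M F"
  shows "F = G"
proof (rule ccontr)
  assume "F \<noteq> G"
  then obtain x where "x \<in> G" "x \<notin> F" using assms by blast
  then have "rk M F < rk M (insert x F)" "rk M (insert x F) \<le> rk M G"
    using assms by (auto simp: flats_def intro!: rk_mono)
  then show False using assms by simp
qed

lemma ground_flat: "ground M \<in> flats M"
  by (simp add: flats_def)

section \<open>Restriction, contraction and their flats\<close>

lemma matroid_restriction: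
  assumes "A \<subseteq> ground M"
  shows "matroid (restriction M A)"
proof
  show "finite (ground (restriction M A))" using assms finite_ground finite_subset by auto
next
  fix I J assume *: "I \<in> indeps (restriction M A)" "J \<in> indeps (restriction M A)" "card I < card J"
  then obtain x where "x \<in> J - I" "insert x I \<in> indeps M"
    using augment[of I J] by (auto simp: restriction_def)
  then show "\<exists>x\<in>J - I. insert x I \<in> indeps (restriction M A)"
    using * by (auto simp: restriction_def)
qed (auto simp: restriction_def empty_indep intro: indep_mono)

lemma rk_restriction: "B \<subseteq> A \<Longrightarrow> rk (restriction M A) B = rk M B"
  unfolding rk_def restriction_def by (rule arg_cong[where f=Max]) auto

lemma bases_restriction:
  assumes "A \<subseteq> ground M"
  shows "bases (restriction M A) = {B \<in> indeps M. B \<subseteq> A \<and> card B = rk M A}"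
  using matroid.bases_eq[OF matroid_restriction[OF assms]] rk_restriction[of A A]
  by (auto simp: restriction_def)

text \<open>Only points outside \<open>G\<close> need an argument: they raise the rank of the flat
  \<open>G\<close>, hence by \<open>rk_insert_eq_mono\<close> that of each of its subsets.\<close>

lemma flats_restriction:
  assumes G: "G \<in> flats M"
  shows "flats (restriction M G) = {F \<in> flats M. F \<subseteq> G}"
proof (intro equalityI subsetI)
  fix F assume F: "F \<in> flats (restriction M G)"
  then have FG: "F \<subseteq> G" by (simp add: flats_def)
  have "rk M F < rk M (insert x F)" if x: "x \<in> ground M - F" for x
  proof (cases "x \<in> G")
    case True
    then have "rk (restriction M G) F < rk (restriction M G) (insert x F)"
      using F x by (auto simp: flats_def)
    then show ?thesis using True FG by (simp add: rk_restriction)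
  next
    case False
    then have "rk M G < rk M (insert x G)" using G x by (auto simp: flats_def)
    then have "rk M (insert x F) \<noteq> rk M F" using rk_insert_eq_mono[OF FG] by fastforce
    then show ?thesis using rk_mono[of F "insert x F"] by (simp add: subset_insertI)
  qed
  then show "F \<in> {F \<in> flats M. F \<subseteq> G}" using FG flat_subset[OF G] by (auto simp: flats_def)
next
  fix F assume F: "F \<in> {F \<in> flats M. F \<subseteq> G}"
  then show "F \<in> flats (restriction M G)"
    using flat_subset[OF G] by (auto simp: flats_def rk_restriction)
qed

lemma restriction_restriction: "B \<subseteq> A \<Longrightarrow> restriction (restriction M A) B = restriction M B"
  by (auto simp: restriction_def)

lemma restriction_ground: "restriction M (ground M) = M"
  using indeps_subset by (auto simp: restriction_def intro!: indep_system.equality)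

text \<open>Joined with a basis of \<open>F\<close>, an independent set of the contraction stays
  independent, which bounds its size. Equality comes from extending a basis of \<open>F\<close>
  inside \<open>A \<union> F\<close>.\<close>

lemma rk_contraction:
  assumes F: "F \<subseteq> ground M" and A: "A \<subseteq> ground M - F"
  shows "rk (contraction M F) A = rk M (A \<union> F) - rk M F"
proof -
  have B: "bases (restriction M F) = {B \<in> indeps M. B \<subseteq> F \<and> card B = rk M F}"
    by (rule bases_restriction[OF F])
  have *: "{I \<in> indeps (contraction M F). I \<subseteq> A} =
     {I. I \<subseteq> A \<and> (\<exists>B\<in>indeps M. B \<subseteq> F \<and> card B = rk M F \<and> I \<union> B \<in> indeps M)}"
    using A unfolding contraction_def B by auto
  show ?thesis unfolding rk_def[of "contraction M F"] *
  proof (rule Max_eqI)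
    show "finite (card ` {I. I \<subseteq> A \<and> (\<exists>B\<in>indeps M. B \<subseteq> F \<and> card B = rk M F \<and> I \<union> B \<in> indeps M)})"
      using finite_subset[OF A] finite_ground by auto
  next
    fix k assume "k \<in> card ` {I. I \<subseteq> A \<and> (\<exists>B\<in>indeps M. B \<subseteq> F \<and> card B = rk M F \<and> I \<union> B \<in> indeps M)}"
    then obtain I C where I: "k = card I" "I \<subseteq> A" "C \<in> indeps M" "C \<subseteq> F" "card C = rk M F"
      "I \<union> C \<in> indeps M" by auto
    have "card (I \<union> C) = card I + card C"
      using I A finite_indep[OF I(6)] by (intro card_Un_disjoint) auto
    moreover have "card (I \<union> C) \<le> rk M (A \<union> F)" using I by (intro card_le_rk) auto
    ultimately show "k \<le> rk M (A \<union> F) - rk M F" using I by simp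
  next
    obtain C where C: "C \<in> indeps M" "C \<subseteq> F" "card C = rk M F" using rk_attained by blast
    then obtain J where J: "J \<in> indeps M" "C \<subseteq> J" "J \<subseteq> A \<union> F" "card J = rk M (A \<union> F)"
      using extend_indep[of C "A \<union> F"] by blast
    \<comment> \<open>\<open>C\<close> already has the largest possible size in \<open>F\<close>, so
      its extension \<open>J\<close> gains nothing inside \<open>F\<close>.\<close>
    have "J \<inter> F \<in> indeps M" using J by (auto intro: indep_mono)
    then have "card (J \<inter> F) \<le> card C" using card_le_rk[of "J \<inter> F" F] C by auto
    then have "J \<inter> F = C" using J C finite_indep[OF J(1)] by (intro card_seteq[symmetric]) auto
    then have "J - C \<subseteq> A" using J by auto
    moreover have "(J - C) \<union> C = J" using J by auto
    moreover have "card (J - C) = rk M (A \<union> F) - rk M F"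
      using card_Diff_subset[of C J] J C finite_indep by simp
    ultimately show "rk M (A \<union> F) - rk M F \<in>
       card ` {I. I \<subseteq> A \<and> (\<exists>B\<in>indeps M. B \<subseteq> F \<and> card B = rk M F \<and> I \<union> B \<in> indeps M)}"
      using C J by (intro image_eqI[of _ _ "J - C"]) auto
  qed
qed

text \<open>The rank of \<open>A\<close> in the contraction is that of \<open>A \<union> F\<close>
  shifted by the constant \<open>rk M F\<close>, so a point raises one exactly when it raises the
  other.\<close>

lemma flats_contraction:
  assumes F: "F \<subseteq> ground M"
  shows "flats (contraction M F) = (\<lambda>G. G - F) ` {G \<in> flats M. F \<subseteq> G}"
proof -
  have key: "A \<in> flats (contraction M F) \<longleftrightarrow> A \<union> F \<in> flats M" if A: "A \<subseteq> ground M - F" for A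
  proof -
    have "rk (contraction M F) A < rk (contraction M F) (insert x A) \<longleftrightarrow>
        rk M (A \<union> F) < rk M (insert x (A \<union> F))" if x: "x \<in> ground M - F - A" for x
      using x A rk_contraction[OF F A] rk_contraction[OF F, of "insert x A"]
        rk_mono[of F "A \<union> F"] by (auto simp: less_diff_iff diff_less_mono)
    then show ?thesis using A F by (auto simp: flats_def contraction_def)
  qed
  show ?thesis
  proof (intro equalityI subsetI)
    fix A assume A: "A \<in> flats (contraction M F)"
    then have "A \<subseteq> ground M - F" by (simp add: flats_def contraction_def)
    with A key show "A \<in> (\<lambda>G. G - F) ` {G \<in> flats M. F \<subseteq> G}"
      by (intro image_eqI[of _ _ "A \<union> F"]) auto
  next
    fix A assume "A \<in> (\<lambda>G. G - F) ` {G \<in> flats M. F \<subseteq> G}"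
    then obtain G where G: "A = G - F" "G \<in> flats M" "F \<subseteq> G" by auto
    then have "A \<subseteq> ground M - F" "A \<union> F = G" using flat_subset by auto
    with G key show "A \<in> flats (contraction M F)" by simp
  qed
qed

end

lemma (in loopless_matroid) loopless_restriction:
  assumes "A \<subseteq> ground M"
  shows "loopless_matroid (restriction M A)"
proof -
  interpret R: matroid "restriction M A" by (rule matroid_restriction[OF assms])
  show ?thesis by unfold_locales (use assms loopless in \<open>auto simp: restriction_def\<close>)
qed

text \<open>Singletons are independent, so a nonempty set has positive rank. This settles the rank 0
  cases of the recursions below.\<close>

lemma (in loopless_matroid) rk_eq_0_iff: "A \<subseteq> ground M \<Longrightarrow> rk M A = 0 \<longleftrightarrow> A = {}"
  using card_le_rk[of "{_}" A] loopless rk_empty by force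


section \<open>Moebius inversion\<close>

lemma finite_interval: "finite G \<Longrightarrow> finite {H. H \<in> L \<and> F \<subseteq> H \<and> H \<subseteq> G}"
  by (rule finite_subset[of _ "Pow G"]) auto

text \<open>For \<open>F \<noteq> G\<close> this is the defining recursion with the term at
  \<open>G\<close> moved to the other side.\<close>

lemma moebius_zeta:
  assumes "finite G" "F \<in> L" "G \<in> L" "F \<subseteq> G"
  shows "(\<Sum>H | H \<in> L \<and> F \<subseteq> H \<and> H \<subseteq> G. moebius L F H) = (if F = G then 1 else 0)"
proof (cases "F = G")
  case True
  then have "{H. H \<in> L \<and> F \<subseteq> H \<and> H \<subseteq> G} = {G}" using assms by auto
  then show ?thesis using True by (simp add: moebius.simps)
next
  case False
  have eq: "{H. H \<in> L \<and> F \<subseteq> H \<and> H \<subseteq> G} = insert G {H. H \<in> L \<and> F \<subseteq> H \<and> H \<subset> G}"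
    using assms by auto
  have "finite {H. H \<in> L \<and> F \<subseteq> H \<and> H \<subset> G}"
    by (rule finite_subset[OF _ finite_interval[OF assms(1)]]) auto
  then show ?thesis unfolding eq using False assms moebius.simps[of L F G] by auto
qed

text \<open>The triangular matrix \<open>D = \<zeta>\<mu>\<close> satisfies \<open>D\<zeta> = \<zeta>\<close>, and this determines it.\<close>

lemma zeta_moebius:
  assumes "finite G" "F \<in> L" "G \<in> L" "F \<subseteq> G"
  shows "(\<Sum>H | H \<in> L \<and> F \<subseteq> H \<and> H \<subseteq> G. moebius L H G) = (if F = G then 1 else 0)"
  using assms
proof (induction "card G" arbitrary: G rule: less_induct)
  case less
  define D where "D K = (\<Sum>H | H \<in> L \<and> F \<subseteq> H \<and> H \<subseteq> K. moebius L H K)" for K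
  let ?I = "{H. H \<in> L \<and> F \<subseteq> H \<and> H \<subseteq> G}"
  note fin = finite_interval[OF less.prems(1)]
  show ?case
  proof (cases "F = G")
    case True
    then have "?I = {G}" using less.prems by auto
    then show ?thesis using True by (simp add: moebius.simps)
  next
    case False
    have "(\<Sum>K\<in>?I. D K) = (\<Sum>K\<in>?I. \<Sum>H\<in>?I. if H \<subseteq> K then moebius L H K else 0)"
    proof (rule sum.cong[OF refl])
      fix K assume K: "K \<in> ?I"
      then have "{H. H \<in> L \<and> F \<subseteq> H \<and> H \<subseteq> K} = {H \<in> ?I. H \<subseteq> K}" by auto
      then show "D K = (\<Sum>H\<in>?I. if H \<subseteq> K then moebius L H K else 0)"
        unfolding D_def by (simp only: sum.inter_filter[OF fin])
    qed
    also have "\<dots> = (\<Sum>H\<in>?I. \<Sum>K\<in>?I. if H \<subseteq> K then moebius L H K else 0)"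
      by (rule sum.swap)
    also have "\<dots> = (\<Sum>H\<in>?I. if H = G then 1 else 0)"
    proof (rule sum.cong[OF refl])
      fix H assume H: "H \<in> ?I"
      then have "{K. K \<in> L \<and> H \<subseteq> K \<and> K \<subseteq> G} = {K \<in> ?I. H \<subseteq> K}" by auto
      then show "(\<Sum>K\<in>?I. if H \<subseteq> K then moebius L H K else 0) = (if H = G then 1 else 0)"
        using moebius_zeta[of G H L] less.prems H by (simp only: sum.inter_filter[OF fin]) simp
    qed
    also have "\<dots> = 1" using less.prems fin by simp
    finally have 1: "(\<Sum>K\<in>?I. D K) = 1" .
    have "D F = 1"
    proof -
      have "{H. H \<in> L \<and> F \<subseteq> H \<and> H \<subseteq> F} = {F}" using less.prems by auto
      then show ?thesis by (simp add: D_def moebius.simps)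
    qed
    \<comment> \<open>Strictly between \<open>F\<close> and \<open>G\<close> the induction
      hypothesis applies. The total 1 is therefore \<open>D F + D G\<close>, and
      \<open>D F = 1\<close> leaves \<open>D G = 0\<close>.\<close>
    moreover have "D K = 0" if K: "K \<in> ?I - {F, G}" for K
    proof -
      have "K \<subset> G" using K by auto
      then show ?thesis
        using less.hyps[of K] K less.prems psubset_card_mono[of G K] finite_subset[of K G]
        by (auto simp: D_def)
    qed
    then have "(\<Sum>K\<in>?I. D K) = (\<Sum>K\<in>{F, G}. D K)"
      using less.prems fin by (intro sum.mono_neutral_right) auto
    ultimately show ?thesis using 1 False by (simp add: D_def)
  qed
qed

text \<open>The recursion consults only members of the family strictly below its upper end. Hence a
  restriction can use the Moebius function of the whole lattice.\<close>

lemma moebius_cong_below: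
  assumes "\<And>H. H \<subset> G \<Longrightarrow> H \<in> L \<longleftrightarrow> H \<in> L'"
  shows "moebius L F G = moebius L' F G"
  using assms
proof (induction "card G" arbitrary: G rule: less_induct)
  case less
  have "moebius L F H = moebius L' F H" if "finite G" "H \<subset> G" for H
    using that less.prems by (intro less.hyps) (auto intro: psubset_card_mono)
  moreover have "{H. H \<in> L \<and> F \<subseteq> H \<and> H \<subset> G} = {H. H \<in> L' \<and> F \<subseteq> H \<and> H \<subset> G}"
    using less.prems by auto
  ultimately show ?case
    by (simp add: moebius.simps[of L F G] moebius.simps[of L' F G])
qed

text \<open>Removing \<open>F\<close> is an order isomorphism on the members of \<open>L\<close>
  above \<open>F\<close>, so the recursions on both sides match. This transports the Moebius
  function to contractions.\<close>

lemma moebius_Diff: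
  assumes "finite G" "F \<subseteq> G"
  shows "moebius ((\<lambda>G. G - F) ` {G \<in> L. F \<subseteq> G}) {} (G - F) = moebius L F G"
  using assms
proof (induction "card G" arbitrary: G rule: less_induct)
  case less
  let ?L = "(\<lambda>G. G - F) ` {G \<in> L. F \<subseteq> G}"
  have image: "{H. H \<in> ?L \<and> {} \<subseteq> H \<and> H \<subset> G - F} = (\<lambda>H. H - F) ` {H. H \<in> L \<and> F \<subseteq> H \<and> H \<subset> G}"
    (is "?A = ?B")
  proof (intro equalityI subsetI)
    fix X assume "X \<in> ?A"
    then obtain H where "H \<in> L" "F \<subseteq> H" "X = H - F" "H - F \<subset> G - F" by blast
    then show "X \<in> ?B" using less.prems by (intro image_eqI[of _ _ H]) auto
  next
    fix X assume "X \<in> ?B"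
    then obtain H where "H \<in> L" "F \<subseteq> H" "X = H - F" "H \<subset> G" by blast
    then show "X \<in> ?A" by blast
  qed
  have "inj_on (\<lambda>H. H - F) {H. H \<in> L \<and> F \<subseteq> H \<and> H \<subset> G}"
    by (rule inj_onI) (metis Diff_partition mem_Collect_eq)
  then have "(\<Sum>H | H \<in> ?L \<and> {} \<subseteq> H \<and> H \<subset> G - F. moebius ?L {} H) =
        (\<Sum>H | H \<in> L \<and> F \<subseteq> H \<and> H \<subset> G. moebius ?L {} (H - F))"
    unfolding image by (simp add: sum.reindex)
  also have "\<dots> = (\<Sum>H | H \<in> L \<and> F \<subseteq> H \<and> H \<subset> G. moebius L F H)"
  proof (rule sum.cong[OF refl])
    fix H assume "H \<in> {H. H \<in> L \<and> F \<subseteq> H \<and> H \<subset> G}"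
    then show "moebius ?L {} (H - F) = moebius L F H"
      using less.prems less.hyps[of H] psubset_card_mono[of G H] finite_subset[of H G] by auto
  qed
  finally show ?case using less.prems
    by (auto simp: moebius.simps[of ?L "{}" "G - F"] moebius.simps[of L F G])
qed


text \<open>Substituting for \<open>f\<close> and exchanging the sums leaves, for each
  \<open>G\<close>, the Moebius sum of \<open>zeta_moebius\<close>, which vanishes unless
  \<open>G = E\<close>.\<close>

lemma moebius_inversion:
  fixes f g :: "'a set \<Rightarrow> 'b :: comm_ring_1"
  assumes fin: "finite L" "finite E" and E: "E \<in> L" and sub: "\<And>K. K \<in> L \<Longrightarrow> K \<subseteq> E"
    and f: "\<And>K. K \<in> L \<Longrightarrow> f K = (\<Sum>G | G \<in> L \<and> G \<subseteq> K. g G)"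
  shows "(\<Sum>K\<in>L. f K * of_int (moebius L K E)) = g E"
proof -
  have "(\<Sum>K\<in>L. f K * of_int (moebius L K E)) =
      (\<Sum>K\<in>L. \<Sum>G | G \<in> L \<and> G \<subseteq> K. g G * of_int (moebius L K E))"
    by (simp add: f sum_distrib_right)
  also have "\<dots> = (\<Sum>G\<in>L. \<Sum>K | K \<in> L \<and> G \<subseteq> K. g G * of_int (moebius L K E))"
    by (rule sum.swap_restrict) (use fin in auto)
  also have "\<dots> = (\<Sum>G\<in>L. if G = E then g G else 0)"
  proof (rule sum.cong[OF refl])
    fix G assume G: "G \<in> L"
    have "{K. K \<in> L \<and> G \<subseteq> K} = {K. K \<in> L \<and> G \<subseteq> K \<and> K \<subseteq> E}" using sub by auto
    then have "(\<Sum>K | K \<in> L \<and> G \<subseteq> K. moebius L K E) = (if G = E then 1 else 0)"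
      using zeta_moebius[of E G L] G E sub fin by simp
    then show "(\<Sum>K | K \<in> L \<and> G \<subseteq> K. g G * of_int (moebius L K E)) = (if G = E then g G else 0)"
      by (simp flip: sum_distrib_left of_int_sum)
  qed
  also have "\<dots> = g E" using fin E by simp
  finally show ?thesis .
qed


section \<open>Recursions for the zeta function and the number of bases\<close>

text \<open>A representative with denominator 1, from which nonvanishing and the value at the origin
  can be read off.\<close>

lemma fract_linear: "of_nat n * fract_var + of_nat r = Fract [:of_nat r, of_nat n:] 1"
  by (simp add: fract_var_def of_nat_fract of_nat_poly)

lemma fract_linear_nonzero: "r > 0 \<Longrightarrow> of_nat n * fract_var + of_nat r \<noteq> 0"
  unfolding fract_linear by (simp add: Zero_fract_def eq_fract)

context loopless_matroid
begin

text \<open>This sum is the value at 1 of the characteristic polynomial of the contraction by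
  \<open>F\<close>; its vanishing makes the division by \<open>x - 1\<close> exact.\<close>

lemma sum_moebius_above:
  assumes F: "F \<in> flats M" "F \<noteq> ground M"
  shows "(\<Sum>G | G \<in> flats M \<and> F \<subseteq> G. moebius (flats M) F G) = 0"
proof -
  have "{G. G \<in> flats M \<and> F \<subseteq> G} = {G. G \<in> flats M \<and> F \<subseteq> G \<and> G \<subseteq> ground M}"
    using flat_subset by auto
  then show ?thesis
    using moebius_zeta[OF finite_ground F(1) ground_flat] F flat_subset by simp
qed

text \<open>If the characteristic polynomial is \<open>(x - 1) q\<close>, then \<open>q\<close> is
  the reduced one and the derivative at 1 equals \<open>q(1)\<close>. Differentiating term by term
  brings down the exponents.\<close>

lemma poly_reduced_char_poly_contraction:
  assumes F: "F \<in> flats M" "F \<noteq> ground M"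
  shows "poly (reduced_char_poly (contraction M F)) 1 =
    (\<Sum>G | G \<in> flats M \<and> F \<subseteq> G. moebius (flats M) F G * int (matroid_rank M - rk M G))"
proof -
  note FE = flat_subset[OF F(1)]
  have ground: "ground (contraction M F) = ground M - F" by (simp add: contraction_def)
  have "inj_on (\<lambda>G. G - F) {G. G \<in> flats M \<and> F \<subseteq> G}"
    by (rule inj_onI) (metis Diff_partition mem_Collect_eq)
  then have "char_poly (contraction M F) = (\<Sum>G | G \<in> flats M \<and> F \<subseteq> G.
      monom (moebius (flats (contraction M F)) {} (G - F))
        (rk (contraction M F) (ground M - F) - rk (contraction M F) (G - F)))"
    unfolding char_poly_def ground by (subst flats_contraction[OF FE]) (simp add: sum.reindex)
  also have "\<dots> = (\<Sum>G | G \<in> flats M \<and> F \<subseteq> G.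
      monom (moebius (flats M) F G) (matroid_rank M - rk M G))"
  proof (rule sum.cong[OF refl])
    fix G assume G: "G \<in> {G. G \<in> flats M \<and> F \<subseteq> G}"
    then have un: "G - F \<union> F = G" "ground M - F \<union> F = ground M" and GE: "G \<subseteq> ground M"
      using FE flat_subset by auto
    have "moebius (flats (contraction M F)) {} (G - F) = moebius (flats M) F G"
      unfolding flats_contraction[OF FE] using moebius_Diff G finite_flat by auto
    moreover have "rk (contraction M F) (ground M - F) = matroid_rank M - rk M F"
      using rk_contraction[OF FE, of "ground M - F"] un by simp
    moreover have "rk (contraction M F) (G - F) = rk M G - rk M F"
      using rk_contraction[OF FE, of "G - F"] un GE by auto
    \<comment> \<open>The subtraction is truncated, so the common shift by \<open>rk M F\<close>
      cancels only with this inequality.\<close>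
    moreover have "rk M F \<le> rk M G" using G by (intro rk_mono) auto
    ultimately show "monom (moebius (flats (contraction M F)) {} (G - F))
        (rk (contraction M F) (ground M - F) - rk (contraction M F) (G - F)) =
        monom (moebius (flats M) F G) (matroid_rank M - rk M G)" by simp
  qed
  finally have char_poly: "char_poly (contraction M F) = (\<Sum>G | G \<in> flats M \<and> F \<subseteq> G.
      monom (moebius (flats M) F G) (matroid_rank M - rk M G))" .
  have "poly (char_poly (contraction M F)) 1 = 0"
    using sum_moebius_above[OF F] by (simp add: char_poly poly_sum poly_monom)
  then obtain q where q: "char_poly (contraction M F) = [:-1, 1:] * q"
    unfolding poly_eq_0_iff_dvd by (auto elim: dvdE)
  then have "reduced_char_poly (contraction M F) = q"
    unfolding reduced_char_poly_def by (metis nonzero_mult_div_cancel_left one_neq_zero pCons_eq_0_iff)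
  moreover have "poly (pderiv (char_poly (contraction M F))) 1 = poly q 1"
    unfolding q pderiv_mult by (simp add: pderiv_pCons)
  moreover have "poly (pderiv (char_poly (contraction M F))) 1 =
    (\<Sum>G | G \<in> flats M \<and> F \<subseteq> G. moebius (flats M) F G * int (matroid_rank M - rk M G))"
    unfolding char_poly
    by (simp add: higher_pderiv_sum[of 1, simplified] pderiv_monom poly_sum poly_monom mult.commute)
  ultimately show ?thesis by simp
qed

section \<open>Relations between the zeta functions and their Moebius transforms on
  restrictions\<close>

lemma Ztop_restriction_empty: "Ztop (restriction M {}) = 1"
  by (subst Ztop.simps) (simp add: rk_restriction rk_empty)

text \<open>Expressing all restrictions through the Moebius function of the one lattice
  \<open>flats M\<close> lets later sums be exchanged. Rank 0 is a separate clause of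
  \<open>Ytop\<close>; there \<open>G\<close> is empty and the sum has one term.\<close>

lemma Ytop_restriction:
  assumes G: "G \<in> flats M"
  shows "Ytop (restriction M G) = (\<Sum>F | F \<in> flats M \<and> F \<subseteq> G.
    Ztop (restriction M F) * of_int (moebius (flats M) F G))"
proof (cases "rk M G = 0")
  case True
  then have "G = {}" using rk_eq_0_iff flat_subset[OF G] by simp
  moreover from this have "{F. F \<in> flats M \<and> F \<subseteq> G} = {{}}" using G by auto
  ultimately show ?thesis
    by (simp add: Ytop_def rk_restriction rk_empty Ztop_restriction_empty moebius.simps)
next
  case False
  have "moebius {F \<in> flats M. F \<subseteq> G} F G = moebius (flats M) F G" for F
    by (rule moebius_cong_below) auto
  then show ?thesis using False
    by (auto simp: Ytop_def rk_restriction flats_restriction[OF G] restriction_restriction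
        intro!: sum.cong)
qed

text \<open>This inverts \<open>Ytop_restriction\<close>: once the sums are exchanged,
  \<open>moebius_zeta\<close> kills every \<open>F\<close> other than \<open>K\<close>.\<close>

lemma Ztop_eq_sum_Ytop:
  assumes K: "K \<in> flats M"
  shows "Ztop (restriction M K) = (\<Sum>G | G \<in> flats M \<and> G \<subseteq> K. Ytop (restriction M G))"
proof -
  let ?L = "{G. G \<in> flats M \<and> G \<subseteq> K}"
  have fin: "finite ?L" using finite_flats by auto
  have "(\<Sum>G\<in>?L. Ytop (restriction M G)) = (\<Sum>G\<in>?L. \<Sum>F | F \<in> ?L \<and> F \<subseteq> G.
      Ztop (restriction M F) * of_int (moebius (flats M) F G))"
    by (intro sum.cong refl) (auto simp: Ytop_restriction intro!: sum.cong)
  also have "\<dots> = (\<Sum>F\<in>?L. \<Sum>G | G \<in> ?L \<and> F \<subseteq> G.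
      Ztop (restriction M F) * of_int (moebius (flats M) F G))"
    by (rule sum.swap_restrict[OF fin fin])
  also have "\<dots> = (\<Sum>F\<in>?L. if F = K then Ztop (restriction M F) else 0)"
  proof (rule sum.cong[OF refl])
    fix F assume F: "F \<in> ?L"
    have "{G. G \<in> ?L \<and> F \<subseteq> G} = {G. G \<in> flats M \<and> F \<subseteq> G \<and> G \<subseteq> K}" by auto
    then have "(\<Sum>G | G \<in> ?L \<and> F \<subseteq> G. moebius (flats M) F G) = (if F = K then 1 else 0)"
      using moebius_zeta[OF finite_flat[OF K] _ K] F by simp
    then show "(\<Sum>G | G \<in> ?L \<and> F \<subseteq> G. Ztop (restriction M F) * of_int (moebius (flats M) F G)) =
        (if F = K then Ztop (restriction M F) else 0)"
      by (simp flip: sum_distrib_left of_int_sum)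
  qed
  also have "\<dots> = Ztop (restriction M K)" using fin K by simp
  finally show ?thesis by simp
qed

text \<open>Clear the denominator and insert the derivative formula for the reduced characteristic
  polynomials. After exchanging the sums, the inner sum over \<open>F\<close> is the one of
  \<open>Ytop_restriction\<close>.\<close>

lemma Ztop_recursion:
  "(of_nat (card (ground M)) * fract_var + of_nat (matroid_rank M)) * Ztop M =
   (\<Sum>G\<in>flats M. of_nat (matroid_rank M - rk M G) * Ytop (restriction M G))"
proof (cases "matroid_rank M = 0")
  case True
  then show ?thesis using rk_eq_0_iff[of "ground M"] by simp
next
  case False
  let ?L = "flats M"
  let ?c = "\<lambda>G. of_nat (matroid_rank M - rk M G) :: rat poly fract"
  have "(of_nat (card (ground M)) * fract_var + of_nat (matroid_rank M)) * Ztop M =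
    (\<Sum>F | F \<in> ?L \<and> F \<noteq> ground M.
       Ztop (restriction M F) * of_int (poly (reduced_char_poly (contraction M F)) 1))"
    using False finite_ground fract_linear_nonzero[of "matroid_rank M" "card (ground M)"]
    by (subst Ztop.simps) simp
  also have "\<dots> = (\<Sum>F | F \<in> ?L \<and> F \<noteq> ground M. \<Sum>G | G \<in> ?L \<and> F \<subseteq> G.
       ?c G * (Ztop (restriction M F) * of_int (moebius ?L F G)))"
    by (intro sum.cong refl)
      (simp add: poly_reduced_char_poly_contraction sum_distrib_left algebra_simps)
  also have "\<dots> = (\<Sum>F\<in>?L. \<Sum>G | G \<in> ?L \<and> F \<subseteq> G.
       ?c G * (Ztop (restriction M F) * of_int (moebius ?L F G)))"
  \<comment> \<open>The term \<open>F = ground M\<close> may be added: the only flat above it is the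
    ground set itself, whose rank difference is 0.\<close>
  proof (rule sum.mono_neutral_left)
    have "{G. G \<in> ?L \<and> ground M \<subseteq> G} = {ground M}" using flat_subset ground_flat by auto
    then show "\<forall>F\<in>?L - {F. F \<in> ?L \<and> F \<noteq> ground M}. (\<Sum>G | G \<in> ?L \<and> F \<subseteq> G.
       ?c G * (Ztop (restriction M F) * of_int (moebius ?L F G))) = 0" by auto
  qed (auto simp: finite_flats)
  also have "\<dots> = (\<Sum>G\<in>?L. \<Sum>F | F \<in> ?L \<and> F \<subseteq> G.
       ?c G * (Ztop (restriction M F) * of_int (moebius ?L F G)))"
    by (rule sum.swap_restrict[OF finite_flats finite_flats])
  also have "\<dots> = (\<Sum>G\<in>?L. ?c G * Ytop (restriction M G))"
    by (intro sum.cong refl) (simp add: Ytop_restriction sum_distrib_left)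
  finally show ?thesis .
qed

text \<open>Splitting \<open>rk M K - rk M G\<close> in \<open>Ztop_recursion\<close> for the
  restriction yields \<open>rk M K\<close> times the sum of all \<open>Ytop\<close>. By
  \<open>Ztop_eq_sum_Ytop\<close> this cancels the rank term on the left.\<close>

lemma card_mult_Ztop_restriction:
  assumes K: "K \<in> flats M"
  shows "of_nat (card K) * fract_var * Ztop (restriction M K) =
    (\<Sum>G | G \<in> flats M \<and> G \<subseteq> K. - (of_nat (rk M G) * Ytop (restriction M G)))"
proof -
  interpret R: loopless_matroid "restriction M K"
    by (rule loopless_restriction[OF flat_subset[OF K]])
  let ?L = "{G. G \<in> flats M \<and> G \<subseteq> K}"
  have "(of_nat (card K) * fract_var + of_nat (rk M K)) * Ztop (restriction M K) =
      (\<Sum>G\<in>?L. of_nat (rk M K - rk M G) * Ytop (restriction M G))"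
    using R.Ztop_recursion
    by (simp add: rk_restriction flats_restriction[OF K] restriction_restriction)
  also have "\<dots> = (\<Sum>G\<in>?L. of_nat (rk M K) * Ytop (restriction M G)
      - of_nat (rk M G) * Ytop (restriction M G))"
    by (intro sum.cong refl) (auto simp: of_nat_diff rk_mono left_diff_distrib)
  also have "\<dots> = of_nat (rk M K) * Ztop (restriction M K)
      + (\<Sum>G\<in>?L. - (of_nat (rk M G) * Ytop (restriction M G)))"
    by (simp add: sum_subtractf sum_negf Ztop_eq_sum_Ytop[OF K] sum_distrib_left)
  finally show ?thesis by (simp add: algebra_simps)
qed

text \<open>Counting pairs \<open>e \<in> K\<close> by their first component, the sum over the flats \<open>K\<close> above
  \<open>closure (insert e G)\<close> vanishes unless this closure is the whole ground set.\<close>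

lemma sum_card_moebius:
  assumes G: "G \<in> flats M"
  shows "(\<Sum>K | K \<in> flats M \<and> G \<subseteq> K. int (card K) * moebius (flats M) K (ground M)) =
    int (card {e \<in> ground M. closure (insert e G) = ground M})"
proof -
  let ?E = "ground M" and ?L = "{K. K \<in> flats M \<and> G \<subseteq> K}"
  have fin: "finite ?L" using finite_flats by auto
  have "(\<Sum>K\<in>?L. int (card K) * moebius (flats M) K ?E) =
      (\<Sum>K\<in>?L. \<Sum>e | e \<in> ?E \<and> e \<in> K. moebius (flats M) K ?E)"
  proof (rule sum.cong[OF refl])
    fix K assume "K \<in> ?L"
    then have "{e. e \<in> ?E \<and> e \<in> K} = K" using flat_subset by auto
    then show "int (card K) * moebius (flats M) K ?E =
        (\<Sum>e | e \<in> ?E \<and> e \<in> K. moebius (flats M) K ?E)" by simp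
  qed
  also have "\<dots> = (\<Sum>e\<in>?E. \<Sum>K | K \<in> ?L \<and> e \<in> K. moebius (flats M) K ?E)"
    by (rule sum.swap_restrict[OF fin finite_ground])
  also have "\<dots> = (\<Sum>e\<in>?E. if closure (insert e G) = ?E then 1 else 0)"
  proof (rule sum.cong[OF refl])
    fix e assume e: "e \<in> ?E"
    then have sub: "insert e G \<subseteq> ?E" using flat_subset[OF G] by auto
    have "{K. K \<in> ?L \<and> e \<in> K} =
        {K. K \<in> flats M \<and> closure (insert e G) \<subseteq> K \<and> K \<subseteq> ?E}"
      using closure_minimal[of _ "insert e G"] subset_closure[OF sub] flat_subset by blast
    then show "(\<Sum>K | K \<in> ?L \<and> e \<in> K. moebius (flats M) K ?E) =
        (if closure (insert e G) = ?E then 1 else 0)"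
      using zeta_moebius[OF finite_ground closure_flat[OF sub] ground_flat]
        flat_subset[OF closure_flat[OF sub]] by simp
  qed
  also have "\<dots> = int (card {e \<in> ?E. closure (insert e G) = ?E})"
    using finite_ground by (simp add: sum.If_cases Int_def)
  finally show ?thesis .
qed

text \<open>With the truncated \<open>matroid_rank M - 1\<close> in place of \<open>Suc\<close>, the
  empty ground set of a rank 0 matroid would count as a hyperplane.\<close>

definition hyperplanes :: "'a set set" where
  "hyperplanes = {H \<in> flats M. Suc (rk M H) = matroid_rank M}"

lemma closure_eq_ground_iff:
  assumes "A \<subseteq> ground M"
  shows "closure A = ground M \<longleftrightarrow> rk M A = matroid_rank M"
  using flat_eqI[OF closure_flat[OF assms], of "ground M"] rk_closure[OF assms]
    flat_subset[OF closure_flat[OF assms]] by auto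

text \<open>A point raises the rank by at most one, so \<open>insert e G\<close> can span only if
  \<open>G\<close> is the ground set or a hyperplane. A hyperplane is a flat, so exactly the points
  outside it work.\<close>

lemma card_closure_insert_eq_ground:
  assumes G: "G \<in> flats M"
  shows "card {e \<in> ground M. closure (insert e G) = ground M} =
    (if G = ground M then card (ground M) else 0) +
    (if G \<in> hyperplanes then card (ground M - G) else 0)"
proof -
  note GE = flat_subset[OF G]
  have iff: "closure (insert e G) = ground M \<longleftrightarrow> rk M (insert e G) = matroid_rank M"
    if "e \<in> ground M" for e
    using closure_eq_ground_iff[of "insert e G"] that GE by simp
  show ?thesis
  proof (cases "G = ground M")
    case True
    then have "{e \<in> ground M. closure (insert e G) = ground M} = ground M"
      using iff by (auto simp: insert_absorb)
    then show ?thesis using True by (simp add: hyperplanes_def)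
  next
    case False
    then have lt: "rk M G < matroid_rank M"
      using flat_eqI[OF G order_refl GE] rk_mono[OF GE] by (meson leI)
    show ?thesis
    proof (cases "G \<in> hyperplanes")
      case True
      have "rk M (insert e G) = matroid_rank M \<longleftrightarrow> e \<notin> G" if e: "e \<in> ground M" for e
      proof
        assume "e \<notin> G"
        then have "rk M G < rk M (insert e G)" using G e by (auto simp: flats_def)
        moreover have "rk M (insert e G) \<le> matroid_rank M" using e GE by (intro rk_mono) auto
        ultimately show "rk M (insert e G) = matroid_rank M"
          using True by (simp add: hyperplanes_def)
      qed (use lt in \<open>auto simp: insert_absorb\<close>)
      then have "{e \<in> ground M. closure (insert e G) = ground M} = ground M - G"
        using iff by auto
      then show ?thesis using True False by simp
    next
      case notH: False
      have "rk M (insert e G) \<noteq> matroid_rank M" for e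
        using rk_insert_le[of e G] lt notH G by (auto simp: hyperplanes_def)
      then have "{e \<in> ground M. closure (insert e G) = ground M} = {}" using iff by auto
      then have "card {e \<in> ground M. closure (insert e G) = ground M} = 0" by (simp only: card.empty)
      then show ?thesis using notH False by simp
    qed
  qed
qed

text \<open>Expanding each \<open>Ztop\<close> in the inverted identity gives
  \<open>Ytop (restriction M G)\<close> the count from \<open>sum_card_moebius\<close> as
  coefficient. The term of the ground set moves to the left; only hyperplanes remain on the
  right.\<close>

lemma Ytop_recursion:
  "(of_nat (card (ground M)) * fract_var + of_nat (matroid_rank M)) * Ytop M =
    - fract_var * (\<Sum>H\<in>hyperplanes. of_nat (card (ground M - H)) * Ytop (restriction M H))"
proof -
  let ?L = "flats M" and ?E = "ground M"
  let ?Y = "\<lambda>G. Ytop (restriction M G)" and ?mu = "moebius (flats M)"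
  \<comment> \<open>Inversion with both sides of \<open>card_mult_Ztop_restriction\<close> as
    \<open>f\<close> and the sum of \<open>g\<close>; here \<open>g\<close> at the top is minus the
    rank times \<open>Ytop M\<close>.\<close>
  have "- (of_nat (matroid_rank M) * Ytop M) =
      (\<Sum>K\<in>?L. of_nat (card K) * fract_var * Ztop (restriction M K) * of_int (?mu K ?E))"
    using moebius_inversion[OF finite_flats finite_ground ground_flat flat_subset
        card_mult_Ztop_restriction] by (simp add: restriction_ground)
  also have "\<dots> = (\<Sum>K\<in>?L. \<Sum>G | G \<in> ?L \<and> G \<subseteq> K.
      fract_var * ?Y G * of_int (int (card K) * ?mu K ?E))"
    by (intro sum.cong refl)
      (simp add: Ztop_eq_sum_Ytop sum_distrib_left sum_distrib_right algebra_simps)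
  also have "\<dots> = (\<Sum>G\<in>?L. \<Sum>K | K \<in> ?L \<and> G \<subseteq> K.
      fract_var * ?Y G * of_int (int (card K) * ?mu K ?E))"
    by (rule sum.swap_restrict[OF finite_flats finite_flats])
  also have "\<dots> = (\<Sum>G\<in>?L. fract_var * ?Y G *
      of_nat (card {e \<in> ?E. closure (insert e G) = ?E}))"
  proof (rule sum.cong[OF refl])
    fix G assume G: "G \<in> ?L"
    show "(\<Sum>K | K \<in> ?L \<and> G \<subseteq> K. fract_var * ?Y G * of_int (int (card K) * ?mu K ?E)) =
        fract_var * ?Y G * of_nat (card {e \<in> ?E. closure (insert e G) = ?E})"
      unfolding sum_distrib_left[symmetric] of_int_sum[symmetric] sum_card_moebius[OF G] by simp
  qed
  also have "\<dots> = (\<Sum>G\<in>?L. if G = ?E then fract_var * ?Y G * of_nat (card ?E) else 0) +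
      (\<Sum>G\<in>?L. if G \<in> hyperplanes then fract_var * ?Y G * of_nat (card (?E - G)) else 0)"
    unfolding sum.distrib[symmetric]
    by (intro sum.cong refl) (auto simp: card_closure_insert_eq_ground algebra_simps)
  also have "(\<Sum>G\<in>?L. if G = ?E then fract_var * ?Y G * of_nat (card ?E) else 0) =
      fract_var * Ytop M * of_nat (card ?E)"
    using ground_flat finite_flats by (simp add: restriction_ground)
  also have "(\<Sum>G\<in>?L. if G \<in> hyperplanes then fract_var * ?Y G * of_nat (card (?E - G)) else 0) =
      (\<Sum>G\<in>hyperplanes. fract_var * ?Y G * of_nat (card (?E - G)))"
  proof -
    have "{G \<in> ?L. G \<in> hyperplanes} = hyperplanes" by (auto simp: hyperplanes_def)
    then show ?thesis using finite_flats by (simp flip: sum.inter_filter)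
  qed
  finally show ?thesis by (simp add: algebra_simps sum_distrib_left sum_negf)
qed

text \<open>Both sides count bases with a marked element, on the right sorted by the hyperplane that
  the unmarked elements span.\<close>

lemma rank_mult_card_bases:
  assumes "matroid_rank M > 0"
  shows "matroid_rank M * card (bases M) =
    (\<Sum>H\<in>hyperplanes. card (ground M - H) * card (bases (restriction M H)))"
proof -
  let ?E = "ground M"
  have bases_res: "bases (restriction M H) = {B \<in> indeps M. B \<subseteq> H \<and> card B = rk M H}"
    if "H \<in> hyperplanes" for H
    using that by (intro bases_restriction flat_subset) (simp add: hyperplanes_def)
  have "bij_betw (\<lambda>(B, e). (closure (B - {e}), e, B - {e})) (SIGMA B:bases M. B)
      (SIGMA H:hyperplanes. (?E - H) \<times> bases (restriction M H))"
  proof (rule bij_betw_byWitness[of _ "\<lambda>(H, e, B). (insert e B, e)"])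
    show "(\<lambda>(B, e). (closure (B - {e}), e, B - {e})) ` (SIGMA B:bases M. B)
      \<subseteq> (SIGMA H:hyperplanes. (?E - H) \<times> bases (restriction M H))"
    proof (rule image_subsetI)
      fix x assume "x \<in> (SIGMA B:bases M. B)"
      then obtain B e where x: "x = (B, e)" and B: "B \<in> bases M" and e: "e \<in> B" by auto
      then have ind: "B \<in> indeps M" and card: "card B = matroid_rank M" by (auto simp: bases_eq)
      have BE: "B \<subseteq> ?E" by (rule indeps_subset[OF ind])
      have ind': "B - {e} \<in> indeps M" by (rule indep_mono[OF ind]) auto
      have card': "Suc (card (B - {e})) = matroid_rank M"
        using card card_Suc_Diff1[OF finite_indep[OF ind] e] by simp
      have sub: "B - {e} \<subseteq> ?E" using BE by auto
      have rk: "rk M (closure (B - {e})) = card (B - {e})"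
        using rk_closure[OF sub] rk_indep[OF ind'] by simp
      have hyp: "closure (B - {e}) \<in> hyperplanes"
        using closure_flat[OF sub] rk card' by (simp add: hyperplanes_def)
      moreover have "e \<notin> closure (B - {e})"
        using rk_indep[OF ind] rk_indep[OF ind'] card card' e
        by (auto simp: closure_def insert_absorb)
      moreover have "B - {e} \<in> bases (restriction M (closure (B - {e})))"
        unfolding bases_res[OF hyp] using ind' rk subset_closure[OF sub] by simp
      ultimately show "(case x of (B, e) \<Rightarrow> (closure (B - {e}), e, B - {e})) \<in>
          (SIGMA H:hyperplanes. (?E - H) \<times> bases (restriction M H))"
        using e BE by (auto simp: x)
    qed
  next
    \<comment> \<open>The inverse map forgets \<open>H\<close>, which must be recovered:
      \<open>B\<close> has full rank in \<open>H\<close>, hence spans it, and a point outside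
      \<open>H\<close> completes \<open>B\<close> to a basis of \<open>M\<close>.\<close>
    have *: "insert e B \<in> bases M \<and> closure B = H \<and> e \<notin> B"
      if H: "H \<in> hyperplanes" and e: "e \<in> ?E - H" and B: "B \<in> bases (restriction M H)" for H e B
    proof -
      have B': "B \<in> indeps M" "B \<subseteq> H" "card B = rk M H" using B bases_res[OF H] by auto
      have HE: "H \<in> flats M" "H \<subseteq> ?E" "Suc (rk M H) = matroid_rank M"
        using H flat_subset by (auto simp: hyperplanes_def)
      have BE: "B \<subseteq> ?E" using B' HE by auto
      have "closure B \<subseteq> H" by (rule closure_minimal[OF HE(1) B'(2)])
      then have clB: "closure B = H"
        using flat_eqI[OF closure_flat[OF BE] HE(2)] rk_closure[OF BE] rk_indep[OF B'(1)] B'(3)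
        by simp
      then have "rk M (insert e B) \<noteq> rk M B" using e by (auto simp: closure_def)
      then have rk: "rk M (insert e B) = matroid_rank M"
        using rk_mono[of B "insert e B"] rk_insert_le[of e B] rk_indep[OF B'(1)] B'(3) HE(3)
        by (simp add: subset_insertI)
      obtain I where I: "I \<in> indeps M" "I \<subseteq> insert e B" "card I = matroid_rank M"
        using rk_attained[of "insert e B"] rk by auto
      have eB: "e \<notin> B" using e B'(2) by auto
      have "card (insert e B) = matroid_rank M"
        using eB finite_indep[OF B'(1)] B'(3) HE(3) by simp
      then have "I = insert e B"
        using I finite_indep[OF B'(1)] by (intro card_subset_eq) auto
      then show ?thesis using I clB eB by (auto simp: bases_eq)
    qed
    show "(\<lambda>(H, e, B). (insert e B, e)) ` (SIGMA H:hyperplanes. (?E - H) \<times> bases (restriction M H))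
        \<subseteq> (SIGMA B:bases M. B)"
    proof (rule image_subsetI)
      fix x assume "x \<in> (SIGMA H:hyperplanes. (?E - H) \<times> bases (restriction M H))"
      then obtain H e B where "x = (H, e, B)" "H \<in> hyperplanes" "e \<in> ?E - H"
        "B \<in> bases (restriction M H)" by auto
      with *[of H e B] show "(case x of (H, e, B) \<Rightarrow> (insert e B, e)) \<in> (SIGMA B:bases M. B)"
        by simp
    qed
    show "\<forall>x\<in>SIGMA H:hyperplanes. (?E - H) \<times> bases (restriction M H).
        (case case x of (H, e, B) \<Rightarrow> (insert e B, e) of
          (B, e) \<Rightarrow> (closure (B - {e}), e, B - {e})) = x"
    proof (rule ballI)
      fix x assume "x \<in> (SIGMA H:hyperplanes. (?E - H) \<times> bases (restriction M H))"
      then obtain H e B where "x = (H, e, B)" "H \<in> hyperplanes" "e \<in> ?E - H"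
        "B \<in> bases (restriction M H)" by auto
      with *[of H e B] show "(case case x of (H, e, B) \<Rightarrow> (insert e B, e) of
          (B, e) \<Rightarrow> (closure (B - {e}), e, B - {e})) = x"
        by simp
    qed
  qed (auto simp: insert_absorb)
  then have "card (SIGMA B:bases M. B) =
      card (SIGMA H:hyperplanes. (?E - H) \<times> bases (restriction M H))"
    by (rule bij_betw_same_card)
  moreover have "card (SIGMA B:bases M. B) = matroid_rank M * card (bases M)"
  proof -
    have "card (SIGMA B:bases M. B) = (\<Sum>B\<in>bases M. card B)"
      using finite_bases finite_indep by (intro card_SigmaI) (auto simp: bases_eq)
    also have "\<dots> = (\<Sum>B\<in>bases M. matroid_rank M)"
      by (intro sum.cong refl) (simp add: bases_eq)
    finally show ?thesis by simp
  qed
  moreover have "card (SIGMA H:hyperplanes. (?E - H) \<times> bases (restriction M H)) =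
      (\<Sum>H\<in>hyperplanes. card (?E - H) * card (bases (restriction M H)))"
  proof -
    have "finite hyperplanes" using finite_flats by (simp add: hyperplanes_def)
    moreover have "finite (bases (restriction M H))" if "H \<in> hyperplanes" for H
      using bases_res[OF that] finite_indeps by simp
    ultimately show ?thesis
      using finite_ground by (simp add: card_SigmaI card_cartesian_product)
  qed
  ultimately show ?thesis by simp
qed

end


section \<open>Rational functions regular at the origin\<close>

text \<open>Any representation with denominator nonzero at 0 is allowed, so closure under arithmetic
  needs no reduction to lowest terms.\<close>

definition regular_value :: "rat poly fract \<Rightarrow> rat \<Rightarrow> bool" where
  "regular_value f c \<longleftrightarrow>
     (\<exists>a b. f = Fract a b \<and> poly b 0 \<noteq> 0 \<and> poly a 0 = c * poly b 0)"

lemma regular_value_0: "regular_value 0 0"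
  unfolding regular_value_def by (intro exI[of _ 0] exI[of _ 1]) (simp add: Zero_fract_def)

lemma regular_value_linear: "regular_value (of_nat n * fract_var + of_nat r) (of_nat r)"
  unfolding regular_value_def fract_linear
  by (intro exI[of _ "[:of_nat r, of_nat n:]"] exI[of _ 1]) simp

lemma regular_value_of_nat: "regular_value (of_nat n) (of_nat n)"
  using regular_value_linear[of 0 n] by simp

lemma regular_value_uminus: "regular_value f c \<Longrightarrow> regular_value (- f) (- c)"
  unfolding regular_value_def by (metis minus_fract minus_mult_left poly_minus)

lemma regular_value_add:
  assumes "regular_value f c" "regular_value g d"
  shows "regular_value (f + g) (c + d)"
proof -
  obtain a b a' b' where "f = Fract a b" "poly b 0 \<noteq> 0" "poly a 0 = c * poly b 0"
    "g = Fract a' b'" "poly b' 0 \<noteq> 0" "poly a' 0 = d * poly b' 0"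
    using assms unfolding regular_value_def by blast
  moreover from this have "b \<noteq> 0" "b' \<noteq> 0" by auto
  ultimately show ?thesis unfolding regular_value_def
    by (intro exI[of _ "a * b' + a' * b"] exI[of _ "b * b'"]) (simp add: algebra_simps)
qed

lemma regular_value_mult:
  assumes "regular_value f c" "regular_value g d"
  shows "regular_value (f * g) (c * d)"
proof -
  obtain a b a' b' where "f = Fract a b" "poly b 0 \<noteq> 0" "poly a 0 = c * poly b 0"
    "g = Fract a' b'" "poly b' 0 \<noteq> 0" "poly a' 0 = d * poly b' 0"
    using assms unfolding regular_value_def by blast
  then show ?thesis unfolding regular_value_def
    by (intro exI[of _ "a * a'"] exI[of _ "b * b'"]) simp
qed

lemma regular_value_divide:
  assumes "regular_value f c" "regular_value g d" "d \<noteq> 0"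
  shows "regular_value (f / g) (c / d)"
proof -
  obtain a b a' b' where "f = Fract a b" "poly b 0 \<noteq> 0" "poly a 0 = c * poly b 0"
    "g = Fract a' b'" "poly b' 0 \<noteq> 0" "poly a' 0 = d * poly b' 0"
    using assms unfolding regular_value_def by blast
  then show ?thesis unfolding regular_value_def using assms(3)
    by (intro exI[of _ "a * b'"] exI[of _ "b * a'"]) simp
qed

lemma regular_value_sum:
  "(\<And>x. x \<in> A \<Longrightarrow> regular_value (f x) (c x)) \<Longrightarrow> regular_value (sum f A) (sum c A)"
  by (induction A rule: infinite_finite_induct) (auto intro: regular_value_0 regular_value_add)

section \<open>Evaluation of rational polynomials in larger fields\<close>

lemma map_poly_of_rat_mult:
  "map_poly of_rat (p * q) = (map_poly of_rat p * map_poly of_rat q :: 'a :: field_char_0 poly)"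
  by (rule poly_eqI) (simp add: coeff_map_poly coeff_mult of_rat_sum of_rat_mult)

lemma map_poly_of_rat_eq_0_iff:
  "map_poly of_rat p = (0 :: 'a :: field_char_0 poly) \<longleftrightarrow> p = 0"
  by (simp add: poly_eq_iff coeff_map_poly)

lemma map_poly_of_rat_X_power:
  "map_poly of_rat ([:0, 1:] ^ n) = ([:0, 1:] ^ n :: 'a :: field_char_0 poly)"
  by (induction n) (simp_all only: power_Suc map_poly_of_rat_mult, simp_all add: map_poly_pCons)

lemma poly_map_poly_of_rat_0:
  "poly (map_poly of_rat p) 0 = (of_rat (poly p 0) :: 'a :: field_char_0)"
  by (simp add: poly_0_coeff_0 coeff_map_poly)

text \<open>The roots other than \<open>a\<close> form a finite, hence closed, set, whose complement
  is a neighbourhood of \<open>a\<close>.\<close>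

lemma eventually_poly_nonzero:
  fixes p :: "'a :: {idom, t1_space} poly"
  assumes "p \<noteq> 0"
  shows "eventually (\<lambda>z. poly p z \<noteq> 0) (at a)"
proof -
  let ?S = "- ({z. poly p z = 0} - {a})"
  have "open ?S"
    by (intro open_Compl finite_imp_closed finite_Diff poly_roots_finite assms)
  then show ?thesis unfolding eventually_at_topological by (intro exI[of _ ?S]) auto
qed

text \<open>The definitions refer to lowest terms \<open>p\<close>, \<open>q\<close>, while
  \<open>g\<close> comes as some \<open>Fract a b\<close>. The identity
  \<open>p * b = [:0, 1:] ^ r * a * q\<close> bridges the two: comparing orders at 0 gives the zero,
  evaluating it gives the limit.\<close>

lemma zero_of_order_limit:
  assumes f: "f = fract_var ^ r * g" and g: "regular_value g c" and c: "c \<noteq> 0"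
  shows "has_zero_of_order f 0 r"
    and "((\<lambda>s :: complex. eval_fract f s / s ^ r) \<longlongrightarrow> of_rat c) (at 0)"
proof -
  obtain a b where ab: "g = Fract a b" "poly b 0 \<noteq> 0" "poly a 0 = c * poly b 0"
    using g unfolding regular_value_def by blast
  obtain p q where pq: "quot_of_fract f = (p, q)" by force
  have X: "fract_var ^ r = Fract ([:0, 1:] ^ r) 1"
    by (induction r) (simp_all add: fract_var_def One_fract_def)
  have nz: "q \<noteq> 0" "b \<noteq> 0" "a \<noteq> 0"
    using snd_quot_of_fract_nonzero[of f] pq ab c by auto
  have "Fract p q = f" using Fract_quot_of_fract[of f] by (simp add: pq)
  also have "f = Fract ([:0, 1:] ^ r * a) b" by (simp add: f X ab)
  finally have "Fract p q = Fract ([:0, 1:] ^ r * a) b" .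
  then have eq: "p * b = [:0, 1:] ^ r * a * q" using nz by (simp add: eq_fract)
  then have p: "p \<noteq> 0" using nz by auto
  have "order 0 (p * b) = order 0 p" using p nz ab order_root[of b 0] by (subst order_mult) auto
  moreover have "order 0 ([:0, 1:] ^ r * a * q) = r + order 0 q"
  proof -
    have "poly a 0 \<noteq> 0" using ab c by simp
    then have "order 0 a = 0" by (simp add: order_root)
    moreover have "order 0 ([:0, 1:] ^ r :: rat poly) = r" using order_power_n_n[of "0 :: rat" r] by simp
    ultimately show ?thesis using nz by (simp add: order_mult)
  qed
  ultimately have "order 0 p = r + order 0 q" using eq by simp
  moreover have "f \<noteq> 0" using p pq by auto
  ultimately show "has_zero_of_order f 0 r" by (simp add: has_zero_of_order_def pq)

  let ?h = "map_poly of_rat :: rat poly \<Rightarrow> complex poly"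
  have eq': "poly (?h p) z * poly (?h b) z = z ^ r * poly (?h a) z * poly (?h q) z" for z
    using arg_cong[OF eq, of "\<lambda>p. poly (?h p) z"]
    by (simp add: map_poly_of_rat_mult map_poly_of_rat_X_power)
  \<comment> \<open>Near 0 but away from it, \<open>z\<close>, \<open>q\<close> and \<open>b\<close>
    are nonzero, so the cross-multiplied identity can be divided out and the value convention at
    poles does not intervene.\<close>
  have "eventually (\<lambda>z. poly (?h a) z / poly (?h b) z = eval_fract f z / z ^ r) (at 0)"
  proof -
    have "eventually (\<lambda>z. poly (?h q) z \<noteq> 0) (at 0)" "eventually (\<lambda>z. poly (?h b) z \<noteq> 0) (at 0)"
      by (intro eventually_poly_nonzero; simp add: map_poly_of_rat_eq_0_iff nz)+
    moreover have "eventually (\<lambda>z :: complex. z \<noteq> 0) (at 0)" by (simp add: eventually_at_filter)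
    ultimately show ?thesis
    proof eventually_elim
      case (elim z)
      then show ?case using eq'[of z] by (simp add: eval_fract_def pq field_simps)
    qed
  qed
  moreover have "((\<lambda>z. poly (?h a) z / poly (?h b) z) \<longlongrightarrow> of_rat c) (at 0)"
  proof -
    have "((\<lambda>z. poly (?h a) z / poly (?h b) z) \<longlongrightarrow> poly (?h a) 0 / poly (?h b) 0) (at 0)"
      using ab(2) by (intro tendsto_intros) (simp add: poly_map_poly_of_rat_0)
    then show ?thesis using ab by (simp add: poly_map_poly_of_rat_0 of_rat_mult)
  qed
  ultimately show "((\<lambda>s :: complex. eval_fract f s / s ^ r) \<longlongrightarrow> of_rat c) (at 0)"
    by (rule Lim_transform_eventually[rotated])
qed

text \<open>Induction on the rank along \<open>Ytop_recursion\<close>: hyperplanes have rank one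
  less, and the extra factor \<open>fract_var\<close> supplies one more order of vanishing. A
  cofactor \<open>g\<close> with known value at 0 carries order and leading coefficient
  together.\<close>

lemma Ytop_leading_coefficient:
  assumes "loopless_matroid M"
  shows "\<exists>g. Ytop M = fract_var ^ matroid_rank M * g \<and>
    regular_value g ((-1) ^ matroid_rank M * of_nat (card (bases M)))"
  using assms
proof (induction "matroid_rank M" arbitrary: M)
  case 0
  interpret loopless_matroid M by (rule 0)
  \<comment> \<open>In rank 0 the empty set is the only basis, so the count 1 matches
    \<open>Ytop M = 1\<close>.\<close>
  have "bases M = {{}}"
    using 0 finite_indep empty_indep by (auto simp: bases_eq)
  then show ?case using 0 regular_value_of_nat[of 1]
    by (intro exI[of _ 1]) (simp add: Ytop_def)
next
  case (Suc r)
  interpret loopless_matroid M by (rule Suc)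
  let ?E = "ground M"
  let ?b = "\<lambda>H. of_nat (card (bases (restriction M H))) :: rat"
  let ?l = "of_nat (card ?E) * fract_var + of_nat (Suc r)"
  have "\<exists>g. Ytop (restriction M H) = fract_var ^ r * g \<and> regular_value g ((-1) ^ r * ?b H)"
    if "H \<in> hyperplanes" for H
  proof -
    have H: "H \<subseteq> ?E" "rk M H = r" using that flat_subset Suc.hyps(2) by (auto simp: hyperplanes_def)
    then show ?thesis
      using Suc.hyps(1)[of "restriction M H"] loopless_restriction[of H] by (simp add: rk_restriction)
  qed
  then obtain g where g: "\<And>H. H \<in> hyperplanes \<Longrightarrow> Ytop (restriction M H) = fract_var ^ r * g H"
    "\<And>H. H \<in> hyperplanes \<Longrightarrow> regular_value (g H) ((-1) ^ r * ?b H)"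
    by metis
  let ?S = "\<Sum>H\<in>hyperplanes. of_nat (card (?E - H)) * g H"
  have "?l * Ytop M = - fract_var * (\<Sum>H\<in>hyperplanes. of_nat (card (?E - H)) * (fract_var ^ r * g H))"
    using Ytop_recursion Suc.hyps(2) g(1) by simp
  also have "\<dots> = fract_var ^ Suc r * (- ?S)"
    by (simp add: sum_distrib_left sum_negf algebra_simps)
  finally have "Ytop M = fract_var ^ Suc r * (- ?S) / ?l"
    using fract_linear_nonzero[of "Suc r" "card ?E"]
    by (metis nonzero_mult_div_cancel_left zero_less_Suc)
  then have "Ytop M = fract_var ^ Suc r * (- ?S / ?l)" by (simp only: times_divide_eq_right)
  moreover have "regular_value (- ?S / ?l) ((-1) ^ Suc r * of_nat (card (bases M)))"
  proof -
    have "regular_value (- ?S / ?l)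
        (- (\<Sum>H\<in>hyperplanes. of_nat (card (?E - H)) * ((-1) ^ r * ?b H)) / of_nat (Suc r))"
      by (intro regular_value_divide regular_value_uminus regular_value_sum regular_value_mult
          regular_value_of_nat regular_value_linear g(2)) simp_all
    moreover have "(\<Sum>H\<in>hyperplanes. of_nat (card (?E - H)) * ((-1) ^ r * ?b H)) =
        (-1) ^ r * of_nat (\<Sum>H\<in>hyperplanes. card (?E - H) * card (bases (restriction M H)))"
      by (simp add: sum_distrib_left algebra_simps)
    \<comment> \<open>The factor \<open>Suc r\<close> produced here cancels the value of
      \<open>?l\<close> at the origin.\<close>
    moreover have "(\<Sum>H\<in>hyperplanes. card (?E - H) * card (bases (restriction M H))) =
        Suc r * card (bases M)"
      using rank_mult_card_bases unfolding Suc.hyps(2)[symmetric] by simp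
    ultimately have "regular_value (- ?S / ?l)
        (- ((-1) ^ r * of_nat (Suc r * card (bases M))) / of_nat (Suc r))"
      by (simp only:)
    moreover have "- ((-1) ^ r * of_nat (Suc r * card (bases M))) / of_nat (Suc r) =
        ((-1) ^ Suc r * of_nat (card (bases M)) :: rat)"
      unfolding of_nat_mult by (simp del: of_nat_Suc)
    ultimately show ?thesis by (simp only:)
  qed
  ultimately show ?case unfolding Suc.hyps(2)[symmetric] by blast
qed

theorem theorem1p4:
  fixes M :: "'a indep_system" and r :: nat
  assumes "loopless_matroid M"
    and "r = matroid_rank M"
  shows "has_zero_of_order (Ytop M) 0 r \<and>
    ((\<lambda>s :: complex. eval_fract (Ytop M) s / s ^ r)
       \<longlongrightarrow> (-1) ^ r * of_nat (card (bases M))) (at 0)"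
proof -
  interpret loopless_matroid M by (rule assms(1))
  obtain g where g: "Ytop M = fract_var ^ r * g"
    "regular_value g ((-1) ^ r * of_nat (card (bases M)))"
    using Ytop_leading_coefficient[OF assms(1)] assms(2) by blast
  \<comment> \<open>A nonzero leading coefficient makes the order exactly \<open>r\<close>, not
    merely at least \<open>r\<close>.\<close>
  have "card (bases M) \<noteq> 0" using finite_bases bases_nonempty by simp
  then have "(-1) ^ r * of_nat (card (bases M)) \<noteq> (0 :: rat)" by simp
  from zero_of_order_limit[OF g this] show ?thesis
    by (simp add: of_rat_mult of_rat_power of_rat_minus)
qed

end
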